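(* Let $k$ be a field, $S=k[t]$, and let $R$ be a $k$-subalgebra of $S$ with $t^{c_0}S\subseteq R$ for a fixed integer $c_0>0$. Let $f\in S$ with $f(0)=1$, let $\ell$ be an integer with $\ell\ge c_0$ and $\ell\ge 2$, and let $g\in S$ be the polynomial of degree at most $\ell-1$ associated with $f$ and $\ell$ (see context). Set $I=fS\cap R$. Then: (1) $I=(t^cf,\,fg)$ (the ideal of $R$ generated by $t^cf$ and $fg$) for every integer $c\ge c_0$, and $IS=fS$. (2) $I$ is a principal ideal of $R$ if and only if $f\in R$. When this is the case, $I=fR$.
   Context: Definition of $g$: write $f=\sum_{i\ge 0}a_it^i$ with $a_i\in k$ (so $a_0=1$), and set $a_m=0$ for $m<0$. Let $A$ be the $(\ell-1)\times\ell$ matrix over $k$ with entries $A_{ij}=a_{i-j}$ for $1\le i\le \ell-1$ and $0\le j\le \ell-1$; that is, its $i$-th row is $(a_i,a_{i-1},\dots,a_1,1,0,\dots,0)$. It has rank $\ell-1$, and there is a unique vector $\mathbf v=(v_0,v_1,\dots,v_{\ell-1})^{T}\in k^{\ell}$ with $A\mathbf v=0$ and $v_0=1$. Put $g=\sum_{i=0}^{\ell-1}v_it^i\in S$. The elements $fg$ and $t^cf$ ($c\ge c_0$) lie in $R$. *)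

theory Defs
  imports
    "HOL-Algebra.Algebraic_Closure_Type"
    "HOL-Algebra.Embedded_Algebras"
    "Jordan_Normal_Form.Matrix"
    "HOL-Computational_Algebra.Polynomial_FPS"
begin

no_notation fps_nth (infixl \<open>$\<close> 75)

text \<open>
  The ring \<open>S = k[t]\<close> is the type \<open>'a poly\<close> over the field \<open>'a\<close>, with \<open>t = monom 1 1\<close>. As the
  subalgebra \<open>R\<close> is a subset of this type, ideals of \<open>R\<close> are expressed with the HOL-Algebra
  notions, applied to \<open>S\<close> viewed as a record and to its restriction to \<open>R\<close>.
\<close>

abbreviation poly_alg :: "'a::field poly ring" where
  "poly_alg \<equiv> ring_of_type_algebra"

abbreviation sub_alg :: "'a::field poly set \<Rightarrow> 'a poly ring" where
  "sub_alg R \<equiv> poly_alg\<lparr>carrier := R\<rparr>"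

text \<open>
  The locale \<open>subalgebra\<close> of \<open>Embedded_Algebras\<close> only demands closure under addition and scalar
  multiplication (a linear subspace), so it is not the notion needed here. A subring of \<open>S\<close>
  (with the same \<open>1\<close>) is a \<open>k\<close>-subalgebra iff it contains the constant polynomials.
\<close>

definition k_subalgebra :: "'a::field poly set \<Rightarrow> bool" where
  "k_subalgebra R \<longleftrightarrow> subring R poly_alg \<and> (\<forall>a. [:a:] \<in> R)"

text \<open>
  Matrix rows are indexed from \<open>0\<close> here, so row \<open>i\<close> of \<open>assoc_mat f l\<close> is row \<open>i + 1\<close> in the
  usual numbering \<open>1, \<dots>, l - 1\<close>: its entries are \<open>a\<^bsub>i+1-j\<^esub>\<close>, with \<open>a\<^sub>m = 0\<close> for \<open>m < 0\<close>.
\<close>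

definition assoc_mat :: "'a::field poly \<Rightarrow> nat \<Rightarrow> 'a mat" where
  "assoc_mat f l = mat (l - 1) l (\<lambda>(i, j). if j \<le> i + 1 then coeff f (i + 1 - j) else 0)"

definition assoc_vec :: "'a::field poly \<Rightarrow> nat \<Rightarrow> 'a vec" where
  "assoc_vec f l =
    (THE v. v \<in> carrier_vec l \<and> assoc_mat f l *\<^sub>v v = 0\<^sub>v (l - 1) \<and> v $ 0 = 1)"

definition assoc_poly :: "'a::field poly \<Rightarrow> nat \<Rightarrow> 'a poly" where
  "assoc_poly f l = (\<Sum>i<l. monom (assoc_vec f l $ i) i)"

text \<open>The description in \<open>assoc_vec\<close> is well-defined.\<close>

lemma assoc_mat_kernel_iff:
  fixes f :: "'a::field poly"
  assumes "v \<in> carrier_vec l"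
  shows "assoc_mat f l *\<^sub>v v = 0\<^sub>v (l - 1) \<longleftrightarrow>
    (\<forall>n. 1 \<le> n \<and> n < l \<longrightarrow> (\<Sum>j\<le>n. coeff f (n - j) * v $ j) = 0)"
proof -
  have row: "(assoc_mat f l *\<^sub>v v) $ i = (\<Sum>j\<le>Suc i. coeff f (Suc i - j) * v $ j)"
    if i: "i < l - 1" for i
  proof -
    have "(assoc_mat f l *\<^sub>v v) $ i =
        (\<Sum>j\<in>{0..<l}. (if j \<le> i + 1 then coeff f (i + 1 - j) else 0) * v $ j)"
      using assms i by (simp add: assoc_mat_def scalar_prod_def)
    also have "\<dots> = (\<Sum>j\<le>Suc i. coeff f (Suc i - j) * v $ j)"
      using i by (intro sum.mono_neutral_cong_right) auto
    finally show ?thesis .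
  qed
  have dim: "dim_vec (assoc_mat f l *\<^sub>v v) = l - 1"
    by (simp add: assoc_mat_def)
  have "assoc_mat f l *\<^sub>v v = 0\<^sub>v (l - 1) \<longleftrightarrow>
      (\<forall>i<l - 1. (\<Sum>j\<le>Suc i. coeff f (Suc i - j) * v $ j) = 0)"
    using dim row by (auto simp add: vec_eq_iff)
  also have "\<dots> \<longleftrightarrow> (\<forall>n. 1 \<le> n \<and> n < l \<longrightarrow> (\<Sum>j\<le>n. coeff f (n - j) * v $ j) = 0)"
  proof (intro iffI allI impI)
    fix n
    assume *: "\<forall>i<l - 1. (\<Sum>j\<le>Suc i. coeff f (Suc i - j) * v $ j) = 0" and n: "1 \<le> n \<and> n < l"
    from n obtain i where "n = Suc i" by (cases n) auto
    with * n show "(\<Sum>j\<le>n. coeff f (n - j) * v $ j) = 0" by auto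
  qed (auto simp del: sum.atMost_Suc)
  finally show ?thesis .
qed

lemma assoc_vec_ex1:
  fixes f :: "'a::field poly"
  assumes f0: "coeff f 0 = 1" and l: "1 \<le> l"
  shows "\<exists>!v. v \<in> carrier_vec l \<and> assoc_mat f l *\<^sub>v v = 0\<^sub>v (l - 1) \<and> v $ 0 = 1"
proof (rule ex_ex1I)
  define w where "w = inverse (fps_of_poly f)"
  define v where "v = vec l (fps_nth w)"
  have v: "v \<in> carrier_vec l" by (simp add: v_def)
  have prod: "w * fps_of_poly f = 1"
    unfolding w_def by (rule inverse_mult_eq_1) (simp add: f0)
  have "(\<Sum>j\<le>n. coeff f (n - j) * v $ j) = 0" if "1 \<le> n" "n < l" for n
  proof -
    have "(\<Sum>j\<le>n. coeff f (n - j) * v $ j) = fps_nth (w * fps_of_poly f) n"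
      using that by (simp add: fps_mult_nth v_def atLeast0AtMost mult.commute)
    with that show ?thesis by (simp add: prod)
  qed
  moreover have "v $ 0 = 1"
    using l f0 by (simp add: v_def w_def)
  ultimately show "\<exists>v. v \<in> carrier_vec l \<and> assoc_mat f l *\<^sub>v v = 0\<^sub>v (l - 1) \<and> v $ 0 = 1"
    using v assoc_mat_kernel_iff[OF v, of f] by blast
next
  fix u v
  assume u: "u \<in> carrier_vec l \<and> assoc_mat f l *\<^sub>v u = 0\<^sub>v (l - 1) \<and> u $ 0 = 1"
    and v: "v \<in> carrier_vec l \<and> assoc_mat f l *\<^sub>v v = 0\<^sub>v (l - 1) \<and> v $ 0 = 1"
  have rec: "x $ n = - (\<Sum>j<n. coeff f (n - j) * x $ j)"
    if "x \<in> carrier_vec l" "assoc_mat f l *\<^sub>v x = 0\<^sub>v (l - 1)" "1 \<le> n" "n < l" for x n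
  proof -
    have "(\<Sum>j\<le>n. coeff f (n - j) * x $ j) = 0"
      using that assoc_mat_kernel_iff by blast
    then show ?thesis
      by (simp add: lessThan_Suc_atMost[symmetric] f0 add_eq_0_iff)
  qed
  have "u $ n = v $ n" if "n < l" for n
    using that
  proof (induction n rule: less_induct)
    case (less n)
    show ?case
    proof (cases "n = 0")
      case False
      have "(\<Sum>j<n. coeff f (n - j) * u $ j) = (\<Sum>j<n. coeff f (n - j) * v $ j)"
        using less by (intro sum.cong) auto
      with False less.prems u v show ?thesis by (simp add: rec)
    qed (use u v in simp)
  qed
  with u v show "u = v" by (intro eq_vecI) auto
qed

end

theory Submission
  imports Defs
begin

text \<open>
  Everything rests on two inversions modulo a power of \<open>t\<close>. If \<open>p(0) = 1\<close>, then \<open>t\<close> divides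
  \<open>1 - p\<close>, so \<open>p\<close> times the geometric sum \<open>w = (\<Sum>i<n. (1 - p)^i)\<close> equals \<open>1\<close> modulo \<open>t^n\<close>; moreover
  \<open>w\<close> lies in every subring containing \<open>p\<close>. The choice of \<open>g\<close> means that \<open>f g\<close> equals \<open>1\<close> modulo
  \<open>t^l\<close>, whence \<open>f g \<in> R\<close>. For \<open>f h \<in> R\<close>, multiplication by \<open>1 - f g\<close> moves \<open>f h\<close> into
  \<open>t^l f S\<close>, and inverting \<open>g\<close> modulo \<open>t^(c + c0)\<close> shows \<open>t^l f S \<subseteq> (t^c f, f g)\<close>.
  If \<open>f \<in> R\<close>, inverting \<open>f\<close> modulo \<open>t^c0\<close> shows that \<open>f h \<in> R\<close> forces \<open>h \<in> R\<close>; conversely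
  a generator of \<open>I\<close> also generates \<open>I S = f S\<close>, so it is a nonzero scalar multiple of \<open>f\<close>.
\<close>

subsection \<open>Ideals of subrings\<close>

context
  fixes R :: "'a::comm_ring_1 set"
  assumes R: "subring R ring_of_type_algebra"
begin

lemma subring_closed:
  shows subring_zero: "0 \<in> R" and subring_one: "1 \<in> R"
    and subring_add: "x \<in> R \<Longrightarrow> y \<in> R \<Longrightarrow> x + y \<in> R"
    and subring_mult: "x \<in> R \<Longrightarrow> y \<in> R \<Longrightarrow> x * y \<in> R"
    and subring_diff: "x \<in> R \<Longrightarrow> y \<in> R \<Longrightarrow> x - y \<in> R"
proof -
  interpret S: ring "ring_of_type_algebra :: 'a ring" by rule
  show "0 \<in> R" "1 \<in> R" and add: "x \<in> R \<Longrightarrow> y \<in> R \<Longrightarrow> x + y \<in> R"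
    and "x \<in> R \<Longrightarrow> y \<in> R \<Longrightarrow> x * y \<in> R" for x y
    using subringE[OF R] by (auto simp: ring_of_type_algebra_def)
  have "\<ominus>\<^bsub>ring_of_type_algebra\<^esub> y = - y" for y :: 'a
    by (rule S.minus_equality) (auto simp: ring_of_type_algebra_def)
  then have "- y \<in> R" if "y \<in> R" for y
    using subringE(5)[OF R that] by simp
  from add[OF _ this, of x y] show "x \<in> R \<Longrightarrow> y \<in> R \<Longrightarrow> x - y \<in> R"
    by simp
qed

lemma subring_power: "x \<in> R \<Longrightarrow> x ^ n \<in> R"
  by (induction n) (auto intro: subring_closed)

lemma subring_sum: "(\<And>i. i \<in> A \<Longrightarrow> h i \<in> R) \<Longrightarrow> sum h A \<in> R"
  by (induction A rule: infinite_finite_induct) (auto intro: subring_closed)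

lemma subring_cring: "cring (ring_of_type_algebra\<lparr>carrier := R\<rparr>)"
proof -
  interpret S: cring "ring_of_type_algebra :: 'a ring" by rule
  have "subcring R ring_of_type_algebra"
    using R by (intro subcring.intro subcring_axioms.intro)
      (auto simp: ring_of_type_algebra_def mult.commute)
  then show ?thesis
    by (subst (asm) S.subcring_iff) (auto simp: ring_of_type_algebra_def)
qed

text \<open>Negatives come from absorption because -1 lies in \<open>R\<close>, and right absorption
  comes from commutativity.\<close>

lemma ideal_subring_iff:
  "ideal J (ring_of_type_algebra\<lparr>carrier := R\<rparr>) \<longleftrightarrow>
    J \<subseteq> R \<and> 0 \<in> J \<and> (\<forall>x\<in>J. \<forall>y\<in>J. x + y \<in> J) \<and> (\<forall>r\<in>R. \<forall>x\<in>J. r * x \<in> J)"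
    (is "ideal J ?R \<longleftrightarrow> ?closed")
proof
  assume "ideal J ?R"
  then interpret ideal J ?R .
  show ?closed
    using a_subset additive_subgroup.zero_closed[OF is_additive_subgroup]
      additive_subgroup.a_closed[OF is_additive_subgroup] I_l_closed
    by (auto simp: ring_of_type_algebra_def)
next
  interpret R: cring ?R by (rule subring_cring)
  assume J: ?closed
  have "subgroup J (add_monoid ?R)"
  proof (rule R.add.subgroupI)
    fix x assume x: "x \<in> J"
    have "- 1 \<in> R"
      using subring_diff[OF subring_zero subring_one] by simp
    with J x have "- x \<in> J" by (metis mult_minus1)
    moreover have "\<ominus>\<^bsub>?R\<^esub> x = - x"
      using J x calculation by (intro R.minus_equality) (auto simp: ring_of_type_algebra_def)
    ultimately show "\<ominus>\<^bsub>?R\<^esub> x \<in> J" by simp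
  qed (use J in \<open>auto simp: ring_of_type_algebra_def\<close>)
  moreover have "x * r \<in> J" if "x \<in> J" "r \<in> R" for x r
    using J that by (metis mult.commute)
  ultimately show "ideal J ?R"
    using J by (intro idealI R.ring_axioms) (auto simp: ring_of_type_algebra_def)
qed

lemma genideal_singleton:
  assumes "x \<in> R"
  shows "Idl\<^bsub>ring_of_type_algebra\<lparr>carrier := R\<rparr>\<^esub> {x} = (\<lambda>r. x * r) ` R"
proof -
  interpret R: cring "ring_of_type_algebra\<lparr>carrier := R\<rparr>" by (rule subring_cring)
  have "PIdl\<^bsub>ring_of_type_algebra\<lparr>carrier := R\<rparr>\<^esub> x = (\<lambda>r. x * r) ` R"
    by (auto simp: cgenideal_def ring_of_type_algebra_def mult.commute)
  with assms show ?thesis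
    by (simp add: R.cgenideal_eq_genideal)
qed

end

subsection \<open>Inversion modulo powers of the variable\<close>

lemma monom_1_dvd_monom_1: "m \<le> n \<Longrightarrow> monom 1 m dvd (monom 1 n :: 'a::comm_semiring_1 poly)"
  by (metis le_add_diff_inverse mult_monom mult_1 dvd_triv_left)

lemma monom_dvd_one_minus_power:
  fixes p :: "'a::comm_ring_1 poly"
  assumes "coeff p 0 = 1"
  shows "monom 1 n dvd (1 - p) ^ n"
proof -
  have "monom 1 1 dvd 1 - p"
    using assms by (simp add: monom_1_dvd_iff')
  then have "monom 1 1 ^ n dvd (1 - p) ^ n" by (rule dvd_power_same)
  then show ?thesis by (simp add: monom_power)
qed

lemma monom_dvd_one_minus_mult_geometric_sum:
  fixes p :: "'a::comm_ring_1 poly"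
  assumes "coeff p 0 = 1"
  shows "monom 1 n dvd 1 - p * (\<Sum>i<n. (1 - p) ^ i)"
proof -
  have "1 - p * (\<Sum>i<n. (1 - p) ^ i) = (1 - p) ^ n"
    using one_diff_power_eq[of "1 - p" n] by (simp add: algebra_simps)
  with monom_dvd_one_minus_power[OF assms] show ?thesis by simp
qed

lemma coeff_assoc_poly: "coeff (assoc_poly f l) n = (if n < l then assoc_vec f l $ n else 0)"
  by (simp add: assoc_poly_def coeff_sum)

text \<open>The kernel equations of the matrix say that coefficients 1 to \<open>l - 1\<close> of
  the product vanish; the normalisation \<open>v $ 0 = 1\<close> takes care of the constant
  coefficient.\<close>

lemma
  fixes f :: "'a::field poly"
  assumes f: "coeff f 0 = 1" and l: "1 \<le> l"
  shows coeff_assoc_poly_0: "coeff (assoc_poly f l) 0 = 1"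
    and monom_dvd_mult_assoc_poly: "monom 1 l dvd 1 - f * assoc_poly f l"
proof -
  define v where "v = assoc_vec f l"
  have v: "v \<in> carrier_vec l" "assoc_mat f l *\<^sub>v v = 0\<^sub>v (l - 1)" "v $ 0 = 1"
    using theI'[OF assoc_vec_ex1[OF f l]] by (auto simp: v_def assoc_vec_def)
  show g0: "coeff (assoc_poly f l) 0 = 1"
    using v(3) l by (simp add: coeff_assoc_poly v_def)
  have "coeff (1 - f * assoc_poly f l) n = 0" if n: "n < l" for n
  proof (cases "n = 0")
    case True
    then show ?thesis by (simp add: coeff_mult f g0)
  next
    case False
    have "coeff (f * assoc_poly f l) n = (\<Sum>j\<le>n. coeff f (n - j) * v $ j)"
      \<comment> \<open>The swap makes the summation index run over the entries of \<open>v\<close>,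
        as in the matrix equations.\<close>
      unfolding mult.commute[of f] coeff_mult
      using n by (intro sum.cong) (auto simp: coeff_assoc_poly v_def)
    also have "\<dots> = 0"
      using v(2) False n assoc_mat_kernel_iff[OF v(1), of f] by auto
    finally show ?thesis using False by simp
  qed
  then show "monom 1 l dvd 1 - f * assoc_poly f l" by (simp add: monom_1_dvd_iff')
qed

subsection \<open>Subrings containing a power of the variable\<close>

context
  fixes R :: "'a::field poly set" and f g :: "'a poly" and c0 l :: nat
  assumes R: "subring R poly_alg"
    and cond: "\<And>h. monom 1 c0 dvd h \<Longrightarrow> h \<in> R"
    and fg: "monom 1 l dvd 1 - f * g"
    and f0: "coeff f 0 = 1" and g0: "coeff g 0 = 1"
    and l: "c0 \<le> l"
begin

text \<open>In this context \<open>g\<close> is any inverse of \<open>f\<close> modulo t^l with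
  constant coefficient 1. As \<open>c0 \<le> l\<close>, the error \<open>1 - f * g\<close> lies in
  \<open>R\<close>.\<close>

lemma mult_inverse_in_subring: "f * g \<in> R"
proof -
  have "1 - f * g \<in> R"
    using fg l by (intro cond) (meson dvd_trans monom_1_dvd_monom_1)
  from subring_diff[OF R subring_one[OF R] this] show ?thesis by simp
qed

lemma intersection_eq_genideal:
  assumes c: "c0 \<le> c"
  shows "range (\<lambda>h. f * h) \<inter> R = Idl\<^bsub>sub_alg R\<^esub> {monom 1 c * f, f * g}"
proof -
  interpret R: cring "sub_alg R" by (rule subring_cring[OF R])
  let ?gens = "{monom 1 c * f, f * g}"
  have gens: "?gens \<subseteq> R"
    using mult_inverse_in_subring cond c by (simp add: dvd_mult2 monom_1_dvd_monom_1)
  then have carrier: "?gens \<subseteq> carrier (sub_alg R)" by simp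
  have ideal: "ideal (range (\<lambda>h. f * h) \<inter> R) (sub_alg R)"
    by (auto simp: ideal_subring_iff[OF R] intro: subring_closed[OF R] simp flip: distrib_left
        simp: mult.left_commute intro: range_eqI[of 0 _ 0])
  define J where "J = Idl\<^bsub>sub_alg R\<^esub> ?gens"
  have "ideal J (sub_alg R)"
    unfolding J_def by (rule R.genideal_ideal[OF carrier])
  then have J_add: "x \<in> J \<Longrightarrow> y \<in> J \<Longrightarrow> x + y \<in> J"
    and J_mult: "r \<in> R \<Longrightarrow> x \<in> J \<Longrightarrow> r * x \<in> J" for x y r
    by (auto simp: ideal_subring_iff[OF R])
  have J_gens: "monom 1 c * f \<in> J" "f * g \<in> J"
    using R.genideal_self[OF carrier] by (auto simp: J_def)
  have high: "f * s \<in> J" if s: "monom 1 c0 dvd s" for s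
  proof -
    \<comment> \<open>The exponent \<open>c + c0\<close> lets the error split into t^c, spent on the
      generator \<open>monom 1 c * f\<close>, and t^c0, which puts its cofactor into
      \<open>R\<close>. The other cofactor \<open>s * w\<close> is in \<open>R\<close> because t^c0
      divides \<open>s\<close>.\<close>
    define w where "w = (\<Sum>i<c + c0. (1 - g) ^ i)"
    have "monom 1 (c + c0) dvd 1 - g * w"
      unfolding w_def by (rule monom_dvd_one_minus_mult_geometric_sum[OF g0])
    then obtain z where "1 - g * w = monom 1 (c + c0) * z" by (elim dvdE)
    then have z: "1 - g * w = monom 1 c * monom 1 c0 * z" by (simp add: mult_monom)
    have "f * s = s * w * (f * g) + f * s * (1 - g * w)"
      by (simp add: algebra_simps)
    also have "f * s * (1 - g * w) = monom 1 c0 * z * s * (monom 1 c * f)"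
      unfolding z by (simp only: mult_ac)
    finally have "f * s = s * w * (f * g) + monom 1 c0 * z * s * (monom 1 c * f)" .
    then show ?thesis
      using J_gens s by (metis J_add J_mult cond dvd_mult2 dvd_triv_left)
  qed
  have "x \<in> J" if x: "x = f * h" "x \<in> R" for x h
  proof -
    \<comment> \<open>Split \<open>x\<close> as \<open>x * (f * g) + f * (h * (1 - f * g))\<close>:
      the first summand is an \<open>R\<close>-multiple of a generator, the second falls under
      \<open>high\<close>.\<close>
    have "monom 1 c0 dvd h * (1 - f * g)"
      using fg l by (meson dvd_mult dvd_trans monom_1_dvd_monom_1)
    then have "f * (h * (1 - f * g)) \<in> J" by (rule high)
    moreover have "x * (f * g) \<in> J"
      using x(2) J_gens J_mult by blast
    ultimately have "x * (f * g) + f * (h * (1 - f * g)) \<in> J"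
      using J_add x(2) by blast
    then show ?thesis by (simp add: x(1) algebra_simps)
  qed
  then have "range (\<lambda>h. f * h) \<inter> R \<subseteq> J" by auto
  moreover have "J \<subseteq> range (\<lambda>h. f * h) \<inter> R"
    unfolding J_def using gens
    by (intro R.genideal_minimal[OF ideal]) (auto simp: mult.commute)
  ultimately show ?thesis by (auto simp: J_def)
qed

text \<open>Even when \<open>f\<close> is outside \<open>R\<close>, it is an
  \<open>S\<close>-combination of elements of the intersection: with \<open>w\<close> inverse to
  \<open>g\<close> modulo t^c0, it equals \<open>(f * g) * w + f * (1 - g * w)\<close>.\<close>

lemma dvd_of_dvd_intersection:
  assumes b: "\<And>x. f dvd x \<Longrightarrow> x \<in> R \<Longrightarrow> b dvd x"
  shows "b dvd f"
proof -
  define w where "w = (\<Sum>i<c0. (1 - g) ^ i)"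
  have "monom 1 c0 dvd 1 - g * w"
    unfolding w_def by (rule monom_dvd_one_minus_mult_geometric_sum[OF g0])
  then have "b dvd f * (1 - g * w)"
    by (intro b cond) auto
  moreover have "b dvd f * g * w"
    using mult_inverse_in_subring by (intro dvd_mult2 b) auto
  ultimately have "b dvd f * g * w + f * (1 - g * w)" by (intro dvd_add)
  then show ?thesis by (simp add: algebra_simps)
qed

lemma genideal_intersection:
  "Idl\<^bsub>poly_alg\<^esub> (range (\<lambda>h. f * h) \<inter> R) = range (\<lambda>h. f * h)"
proof -
  interpret S: cring "poly_alg :: 'a poly ring" by rule
  have S: "carrier poly_alg = (UNIV :: 'a poly set)" by (simp add: ring_of_type_algebra_def)
  \<comment> \<open>Viewing \<open>S\<close> as a subring of itself makes the ideal criterion for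
    subrings available for \<open>S\<close>.\<close>
  have S': "subring UNIV (poly_alg :: 'a poly ring)"
    using S.carrier_is_subring S by simp
  have upd: "poly_alg\<lparr>carrier := UNIV\<rparr> = (poly_alg :: 'a poly ring)"
    by (simp add: ring_of_type_algebra_def)
  note iff = ideal_subring_iff[OF S', unfolded upd]
  define J where "J = Idl\<^bsub>poly_alg\<^esub> (range (\<lambda>h. f * h) \<inter> R)"
  have J: "ideal J poly_alg"
    unfolding J_def by (rule S.genideal_ideal) (simp add: S)
  then have J_add: "x \<in> J \<Longrightarrow> y \<in> J \<Longrightarrow> x + y \<in> J" and J_mult: "x \<in> J \<Longrightarrow> r * x \<in> J" for x y r
    by (auto simp: iff)
  have J_sup: "x \<in> J" if "f dvd x" "x \<in> R" for x
    using S.genideal_self[of "range (\<lambda>h. f * h) \<inter> R"] that unfolding J_def S by blast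
  define w where "w = (\<Sum>i<c0. (1 - g) ^ i)"
  have "monom 1 c0 dvd 1 - g * w"
    unfolding w_def by (rule monom_dvd_one_minus_mult_geometric_sum[OF g0])
  then have "f * (1 - g * w) \<in> J"
    by (intro J_sup cond) auto
  moreover have "w * (f * g) \<in> J"
    using mult_inverse_in_subring by (auto intro: J_mult[OF J_sup])
  ultimately have "w * (f * g) + f * (1 - g * w) \<in> J" by (intro J_add)
  then have "f \<in> J" by (simp add: algebra_simps)
  then have "range (\<lambda>h. f * h) \<subseteq> J"
    using J_mult by (auto simp: mult.commute[of f])
  moreover have "ideal (range (\<lambda>h. f * h)) poly_alg"
    by (auto simp: iff intro: range_eqI[of 0 _ 0] simp flip: distrib_left simp: mult.left_commute)
  then have "J \<subseteq> range (\<lambda>h. f * h)"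
    unfolding J_def by (rule S.genideal_minimal) auto
  ultimately show ?thesis by (simp add: J_def)
qed

text \<open>Write \<open>h\<close> as \<open>w * (f * h) + h * (1 - f * w)\<close>. Here
  \<open>w\<close> is a polynomial expression in \<open>f\<close>, hence in \<open>R\<close>, and
  the second summand is divisible by t^c0.\<close>

lemma quotient_in_subring:
  assumes f: "f \<in> R" and fh: "f * h \<in> R"
  shows "h \<in> R"
proof -
  define w where "w = (\<Sum>i<c0. (1 - f) ^ i)"
  have w: "w \<in> R"
    unfolding w_def using f
    by (intro subring_sum subring_power subring_diff subring_one R)
  have "monom 1 c0 dvd 1 - f * w"
    unfolding w_def by (rule monom_dvd_one_minus_mult_geometric_sum[OF f0])
  then have "h * (1 - f * w) \<in> R" by (intro cond) auto
  from subring_add[OF R subring_mult[OF R w fh] this] show ?thesis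
    by (simp add: algebra_simps)
qed

lemma intersection_eq_multiples:
  assumes "f \<in> R"
  shows "range (\<lambda>h. f * h) \<inter> R = (\<lambda>r. f * r) ` R"
  using assms quotient_in_subring by (auto intro: subring_mult[OF R])

lemma principal_intersection_iff:
  assumes const: "\<And>a. [:a:] \<in> R"
  shows "principalideal (range (\<lambda>h. f * h) \<inter> R) (sub_alg R) \<longleftrightarrow> f \<in> R"
proof
  assume "principalideal (range (\<lambda>h. f * h) \<inter> R) (sub_alg R)"
  then obtain b where b: "b \<in> R" "range (\<lambda>h. f * h) \<inter> R = Idl\<^bsub>sub_alg R\<^esub> {b}"
    by (auto dest: principalideal.generate)
  then have gen: "range (\<lambda>h. f * h) \<inter> R = (\<lambda>r. b * r) ` R"
    by (simp add: genideal_singleton[OF R])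
  have "b = b * 1" by simp
  then have "b \<in> (\<lambda>r. b * r) ` R"
    using subring_one[OF R] by (rule image_eqI)
  then obtain h where h: "b = f * h"
    unfolding gen[symmetric] by blast
  \<comment> \<open>It is not yet known that \<open>f\<close> is in \<open>R\<close>, so
    divisibility is derived from the elements of the intersection. Then \<open>b\<close> and
    \<open>f\<close> are associates in \<open>S\<close>, and \<open>h\<close> is a unit.\<close>
  have "b dvd f"
  proof (rule dvd_of_dvd_intersection)
    fix x assume "f dvd x" "x \<in> R"
    then have "x \<in> (\<lambda>r. b * r) ` R"
      unfolding gen[symmetric] by (auto elim: dvdE)
    then show "b dvd x" by auto
  qed
  then have "f * h dvd f * 1" by (simp add: h)
  moreover have "f \<noteq> 0" using f0 by auto
  ultimately have "h dvd 1" by (simp only: dvd_mult_cancel_left) auto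
  then obtain a where a: "h = [:a:]" "a \<noteq> 0"
    by (auto simp: is_unit_poly_iff dvd_field_iff)
  \<comment> \<open>Since \<open>R\<close> contains the constants, undoing the scalar
    \<open>a\<close> stays inside \<open>R\<close>.\<close>
  have "f = [:inverse a:] * b"
    using a by (simp add: h)
  then show "f \<in> R"
    using subring_mult[OF R const b(1)] by metis
next
  interpret R: cring "sub_alg R" by (rule subring_cring[OF R])
  assume f: "f \<in> R"
  then have eq: "range (\<lambda>h. f * h) \<inter> R = Idl\<^bsub>sub_alg R\<^esub> {f}"
    by (simp add: intersection_eq_multiples genideal_singleton[OF R])
  show "principalideal (range (\<lambda>h. f * h) \<inter> R) (sub_alg R)"
    using f unfolding eq by (intro principalidealI R.genideal_ideal) auto
qed

end

theorem theorem2p4: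
  fixes R :: "'a::field poly set"
    and f g :: "'a poly"
    and c0 l :: nat
    and I :: "'a poly set"
  assumes R: "k_subalgebra R"
    and c0: "0 < c0"
    and cond: "range (\<lambda>h. monom 1 c0 * h) \<subseteq> R"
    and f: "poly f 0 = 1"
    and l: "c0 \<le> l" "2 \<le> l"
    and g: "g = assoc_poly f l"
    and I: "I = range (\<lambda>h. f * h) \<inter> R"
  shows "((\<forall>c\<ge>c0. monom 1 c * f \<in> R \<and> f * g \<in> R \<and>
             I = Idl\<^bsub>sub_alg R\<^esub> {monom 1 c * f, f * g}) \<and>
          Idl\<^bsub>poly_alg\<^esub> I = range (\<lambda>h. f * h)) \<and>
         (principalideal I (sub_alg R) \<longleftrightarrow> f \<in> R) \<and>
         (f \<in> R \<longrightarrow> I = (\<lambda>r. f * r) ` R)"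
proof -
  have sub: "subring R poly_alg" and const: "\<And>a. [:a:] \<in> R"
    using R by (auto simp: k_subalgebra_def)
  have cond': "h \<in> R" if "monom 1 c0 dvd h" for h
    using that cond by (auto elim: dvdE)
  have f0: "coeff f 0 = 1" using f by (simp add: poly_0_coeff_0)
  have l': "1 \<le> l" using l by simp
  note props = sub cond' monom_dvd_mult_assoc_poly[OF f0 l', folded g] f0
    coeff_assoc_poly_0[OF f0 l', folded g] l(1)
  have "monom 1 c * f \<in> R" if "c0 \<le> c" for c
    using that by (intro cond' dvd_mult2 monom_1_dvd_monom_1)
  moreover note mult_inverse_in_subring[OF props] intersection_eq_genideal[OF props]
    genideal_intersection[OF props] principal_intersection_iff[OF props const]
    intersection_eq_multiples[OF props]
  ultimately show ?thesis unfolding I by blast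
qed

end
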